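(* For every integer $q\ge 2$, \[ K(2,q)=P_q-\sum_{i=0}^{q-2}P_i\cdot g_{q-2-i}. \]
   Context: **The polynomial $K$.** $K$ assigns to each unoriented link diagram an element of $\mathbb{Z}[a^{\pm1},z^{\pm1}]$, is invariant under planar isotopy and Reidemeister moves II and III, and satisfies: $K(L_+)+K(L_-)=z\,(K(L_a)+K(L_b))$, where $L_+,L_-,L_a,L_b$ are identical outside a disk in which they are respectively a crossing, the opposite crossing, and its two smoothings; $K(L_{pos})=a^{-1}K(L)$ when $L_{pos}$ is obtained from $L$ by adding a positive kink (Reidemeister I curl with positive crossing) and $K(L_{neg})=aK(L)$ for a negative kink; $K(O)=1$ for the crossingless unknot diagram $O$; $K(L\sqcup O)=\left(\frac{a+a^{-1}}{z}-1\right)K(L)$. (The Kauffman polynomial is obtained from $K$ by multiplying by a power of $a$ depending on the writhe.) **Notation.** $K(2,q)$ is the value of $K$ on the standard diagram of the $(2,q)$ torus link, i.e. the closure of the $2$-braid $\sigma_1^q$, $q\ge 0$, where $\sigma_1$ is a positive crossing when both strands are oriented in the same direction. Thus $K(2,0)=\frac{a+a^{-1}}{z}-1$ and $K(2,1)=a^{-1}$. $P_q$ for $q\ge2$ is the polynomial \[ P_q=\ell D^{q-1}+\sum_{i=1}^{q-1} d\,L^{i}D^{q-1-i} \] (the sum of the activity words of the perfect matchings of the balanced overlaid Tait graph of the $(2,q)$ torus knot), with its letters specialized by $L=a=\ell^{-1}$ and $D=d=z$. Moreover $P_0:=K(2,0)=\frac{a+a^{-1}}{z}-1$ and $P_1:=K(2,1)=a^{-1}$.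 The polynomials $g_n\in\mathbb{Z}[z]$ are defined by $g_0=1$, $g_1=z$, $g_n=zg_{n-1}-g_{n-2}$ for $n\ge2$. *)

theory Defs
  imports
    "HOL-Computational_Algebra.Polynomial"
    "HOL-Library.Poly_Mapping"
    "HOL-Library.Product_Plus"
begin

text \<open>
  \<open>\<int>[a\<^sup>\<plusminus>\<^sup>1, z\<^sup>\<plusminus>\<^sup>1]\<close> is the group ring of \<open>\<int> \<times> \<int>\<close>: the exponent pair \<open>(i, j)\<close> stands for the
  monomial \<open>a\<^sup>i z\<^sup>j\<close>, and the product of \<^typ>\<open>(int \<times> int) \<Rightarrow>\<^sub>0 int\<close> is convolution.
\<close>

type_synonym laurent = "(int \<times> int) \<Rightarrow>\<^sub>0 int"

abbreviation laurent_monom :: "int \<Rightarrow> int \<Rightarrow> laurent" where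
  "laurent_monom i j \<equiv> Poly_Mapping.single (i, j) 1"

definition var_a :: laurent where "var_a = laurent_monom 1 0"
definition var_a_inv :: laurent where "var_a_inv = laurent_monom (-1) 0"
definition var_z :: laurent where "var_z = laurent_monom 0 1"
definition var_z_inv :: laurent where "var_z_inv = laurent_monom 0 (-1)"

definition circle_value :: laurent where
  "circle_value = (var_a + var_a_inv) * var_z_inv - 1"


text \<open>
  A plane diagram in general position with respect to the height function is cut by horizontal
  lines into slices containing one minimum, one maximum or one crossing each. It is represented by
  the list of its slices, read from bottom to top. In a slice \<open>(e, i)\<close> the elementary piece \<open>e\<close> has
  exactly \<open>i\<close> vertical strands to its left; strands are numbered from the left, starting at 0.

  \<open>Cup\<close> is a minimum (two new strands \<open>i\<close>, \<open>i + 1\<close> appear), \<open>Cap\<close> is a maximum (strands \<open>i\<close>, \<open>i + 1\<close>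
  are joined), and \<open>Cross s\<close> crosses strands \<open>i\<close> and \<open>i + 1\<close>. In \<open>Cross Pos\<close> the strand running from
  bottom left to top right passes over, in \<open>Cross Neg\<close> it passes under. So the label is the sign of
  the crossing when both of its strands are oriented upwards (or both downwards); it is not the
  sign when one strand points up and the other down.
\<close>

datatype sign = Pos | Neg

fun opposite :: "sign \<Rightarrow> sign" where
  "opposite Pos = Neg"
| "opposite Neg = Pos"

datatype piece = Cup | Cap | Cross sign

type_synonym slice = "piece \<times> nat"

fun inputs :: "piece \<Rightarrow> nat" where
  "inputs Cup = 0"
| "inputs Cap = 2"
| "inputs (Cross s) = 2"

fun outputs :: "piece \<Rightarrow> nat" where
  "outputs Cup = 2"
| "outputs Cap = 0"
| "outputs (Cross s) = 2"

text \<open>\<open>tangle m w n\<close>: the slices \<open>w\<close> fit together to a tangle diagram with \<open>m\<close> ends at the bottom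
  and \<open>n\<close> ends at the top.\<close>

fun tangle :: "nat \<Rightarrow> slice list \<Rightarrow> nat \<Rightarrow> bool" where
  "tangle m [] n \<longleftrightarrow> m = n"
| "tangle m ((e, i) # w) n \<longleftrightarrow> i + inputs e \<le> m \<and> tangle (m - inputs e + outputs e) w n"

text \<open>The empty diagram is excluded: with \<open>K O = 1\<close> and the rule for adding a circle it would
  have to have a value inverse to \<open>(a + a\<inverse>)/z - 1\<close>, which is not a unit.\<close>

definition link_diagram :: "slice list \<Rightarrow> bool" where
  "link_diagram w \<longleftrightarrow> w \<noteq> [] \<and> tangle 0 w 0"

text \<open>
  Generators of planar isotopy, each applied inside a larger diagram: slices acting on disjoint
  groups of strands exchange their heights; a maximum and an adjacent minimum on a strand cancel;
  a strand crossing one leg of a minimum or maximum is moved across the extremum to the other leg.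
  In the last two rules the label changes although the over-strand remains the same, because the
  leg on the other side of the extremum slopes the other way.
\<close>

inductive planar_move :: "slice list \<Rightarrow> slice list \<Rightarrow> bool" where
  exchange: "i \<le> j \<Longrightarrow> planar_move [(e, i), (f, j + outputs e)] [(f, j + inputs e), (e, i)]"
| zigzag_left: "planar_move [(Cup, i + 1), (Cap, i)] []"
| zigzag_right: "planar_move [(Cup, i), (Cap, i + 1)] []"
| slide_cup: "planar_move [(Cup, i), (Cross s, i + 1)] [(Cup, i + 1), (Cross (opposite s), i)]"
| slide_cap: "planar_move [(Cross s, i + 1), (Cap, i)] [(Cross (opposite s), i), (Cap, i + 1)]"

text \<open>In the third Reidemeister move one strand lies above and one below the two others; the
  condition excludes the two choices of crossings that are cyclic.\<close>

inductive reidemeister_move :: "slice list \<Rightarrow> slice list \<Rightarrow> bool" where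
  R2: "reidemeister_move [(Cross s, i), (Cross (opposite s), i)] []"
| R3: "s = t \<or> t = r \<Longrightarrow>
    reidemeister_move [(Cross s, i), (Cross t, i + 1), (Cross r, i)]
                      [(Cross r, i + 1), (Cross t, i), (Cross s, i + 1)]"

text \<open>A curl on strand \<open>i\<close>, with its loop to the right or to the left of the strand. Following the
  strand, the crossing is traversed upwards both times, so its sign is \<open>s\<close>.\<close>

inductive kink :: "sign \<Rightarrow> slice list \<Rightarrow> bool" for s :: sign where
  kink_right: "kink s [(Cup, i + 1), (Cross s, i), (Cap, i + 1)]"
| kink_left: "kink s [(Cup, i), (Cross s, i + 1), (Cap, i)]"


text \<open>
  Throughout, \<open>u\<close> and \<open>v\<close> are the parts of the diagram below and above the disk in which it is
  changed. The smoothings of a crossing at \<open>i\<close> are the two vertical strands \<open>[]\<close> and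
  \<open>[(Cap, i), (Cup, i)]\<close>.
\<close>

locale kauffman_K =
  fixes K :: "slice list \<Rightarrow> laurent"
  assumes planar_isotopy:
      "\<lbrakk>planar_move s t; link_diagram (u @ s @ v); link_diagram (u @ t @ v)\<rbrakk>
        \<Longrightarrow> K (u @ s @ v) = K (u @ t @ v)"
    and reidemeister_2_3:
      "\<lbrakk>reidemeister_move s t; link_diagram (u @ s @ v); link_diagram (u @ t @ v)\<rbrakk>
        \<Longrightarrow> K (u @ s @ v) = K (u @ t @ v)"
    and skein:
      "link_diagram (u @ [(Cross Pos, i)] @ v)
        \<Longrightarrow> K (u @ [(Cross Pos, i)] @ v) + K (u @ [(Cross Neg, i)] @ v)
            = var_z * (K (u @ v) + K (u @ [(Cap, i), (Cup, i)] @ v))"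
    and positive_kink:
      "\<lbrakk>kink Pos c; link_diagram (u @ c @ v); link_diagram (u @ v)\<rbrakk>
        \<Longrightarrow> K (u @ c @ v) = var_a_inv * K (u @ v)"
    and negative_kink:
      "\<lbrakk>kink Neg c; link_diagram (u @ c @ v); link_diagram (u @ v)\<rbrakk>
        \<Longrightarrow> K (u @ c @ v) = var_a * K (u @ v)"
    and unknot: "K [(Cup, 0), (Cap, 0)] = 1"
    and add_circle:
      "\<lbrakk>link_diagram (u @ [(Cup, i), (Cap, i)] @ v); link_diagram (u @ v)\<rbrakk>
        \<Longrightarrow> K (u @ [(Cup, i), (Cap, i)] @ v) = circle_value * K (u @ v)"


definition closure_2_braid :: "slice list \<Rightarrow> slice list" where
  "closure_2_braid b = [(Cup, 0), (Cup, 1)] @ b @ [(Cap, 1), (Cap, 0)]"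

definition torus_link_2 :: "nat \<Rightarrow> slice list" where
  "torus_link_2 q = closure_2_braid (replicate q (Cross Pos, 0))"


text \<open>The arguments are the letters \<open>\<ell>\<close>, \<open>d\<close>, \<open>L\<close>, \<open>D\<close> of the activity words; used for \<open>q \<ge> 2\<close> only.\<close>

definition activity_sum :: "laurent \<Rightarrow> laurent \<Rightarrow> laurent \<Rightarrow> laurent \<Rightarrow> nat \<Rightarrow> laurent" where
  "activity_sum l d L D q = l * D ^ (q - 1) + (\<Sum>i = 1..q - 1. d * L ^ i * D ^ (q - 1 - i))"

definition P :: "nat \<Rightarrow> laurent" where
  "P q = (if q = 0 then circle_value
          else if q = 1 then var_a_inv
          else activity_sum var_a_inv var_z var_a var_z q)"

fun g :: "nat \<Rightarrow> int poly" where
  "g 0 = 1"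
| "g (Suc 0) = [:0, 1:]"
| "g (Suc (Suc n)) = [:0, 1:] * g (Suc n) - g n"

text \<open>The inclusion of \<open>\<int>[z]\<close> in the Laurent polynomials.\<close>

definition of_z_poly :: "int poly \<Rightarrow> laurent" where
  "of_z_poly p = poly (map_poly of_int p) var_z"

end

theory Submission
  imports Defs
begin

text \<open>
  Write \<open>K\<^sub>q\<close> for the value on the closure of \<open>\<sigma>\<^sub>1\<^sup>q\<close>. The skein relation at the last crossing of
  \<open>\<sigma>\<^sub>1\<^bsup>q+2\<^esup>\<close> compares four diagrams. Switching the crossing cancels it against its neighbour and
  gives \<open>K\<^sub>q\<close>; the vertical smoothing gives \<open>K\<^bsub>q+1\<^esub>\<close>; the horizontal smoothing leaves an unknot on
  which the other \<open>q + 1\<close> crossings have become curls. The two strands of such a curl run through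
  the crossing in opposite directions, so its sign is opposite to its label, and each curl
  contributes a factor \<open>a\<close>. Hence \<open>K\<^bsub>q+2\<^esub> = z K\<^bsub>q+1\<^esub> - K\<^sub>q + z a\<^bsup>q+1\<^esup>\<close>
  (\<open>torus_recurrence\<close>).

  The activity sums agree with \<open>K\<^sub>q\<close> for \<open>q = 0, 1\<close> and satisfy the same recurrence without the
  term \<open>- K\<^sub>q\<close>, namely \<open>P\<^bsub>q+2\<^esub> = z P\<^bsub>q+1\<^esub> + z a\<^bsup>q+1\<^esup>\<close> (\<open>P_recurrence\<close>). So \<open>P\<close> fails the
  recurrence of \<open>K\<close> exactly by \<open>P\<^sub>q\<close> at step \<open>q\<close>. The polynomials \<open>g\<^sub>n\<close> are the fundamental solution
  of the homogeneous recurrence \<open>x\<^bsub>n+2\<^esub> = z x\<^bsub>n+1\<^esub> - x\<^sub>n\<close>: a unit error at step \<open>i\<close> changes the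
  solution at \<open>q\<close> by \<open>g\<^bsub>q-2-i\<^esub>\<close>. Superposing the errors, as in Duhamel's principle, yields the
  correction \<open>\<Sum>\<^sub>i P\<^sub>i g\<^bsub>q-2-i\<^esub>\<close> (\<open>second_order_recurrence_solution\<close>).
\<close>

lemma tangle_append:
  "tangle m (u @ v) n \<longleftrightarrow> (\<exists>k. tangle m u k \<and> tangle k v n)"
proof (induction u arbitrary: m)
  case (Cons x u)
  then show ?case by (cases x) auto
qed simp

lemma tangle_replicate_Cross:
  "i + 2 \<le> m \<Longrightarrow> tangle m (replicate n (Cross s, i)) k \<longleftrightarrow> m = k"
  by (induction n) (simp_all flip: add_2_eq_Suc')

lemma link_diagram_appendI:
  "\<lbrakk>tangle 0 u k; tangle k w 0; u @ w \<noteq> []\<rbrakk> \<Longrightarrow> link_diagram (u @ w)"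
  unfolding link_diagram_def tangle_append by blast

context kauffman_K
begin

text \<open>
  A positive label below a maximum is a negative curl. The kink rules speak of a curl on a vertical
  strand, so start from a negative curl on the left leg of the maximum, with its loop to the left.
  It has two maxima side by side; after exchanging their heights, the crossing slides over the
  original maximum to its right leg, which changes the label. There it lies beside the minimum of
  the curl, can be moved below it, and the minimum cancels against a maximum.
\<close>

lemma curl_below_Cap:
  assumes u: "tangle 0 u k" and k: "i + 2 \<le> k" and v: "tangle (k - 2) v 0"
  shows "K (u @ [(Cross Pos, i), (Cap, i)] @ v) = var_a * K (u @ [(Cap, i)] @ v)"
proof -
  have "K (u @ [(Cup, i), (Cross Neg, i + 1), (Cap, i)] @ [(Cap, i)] @ v)
      = var_a * K (u @ [(Cap, i)] @ v)"
    by (intro negative_kink kink.kink_left link_diagram_appendI[OF u])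
       (use k v in \<open>auto simp: numeral_2_eq_2\<close>)
  moreover have "K ((u @ [(Cup, i), (Cross Neg, i + 1)]) @ [(Cap, i), (Cap, i + outputs Cap)] @ v)
      = K ((u @ [(Cup, i), (Cross Neg, i + 1)]) @ [(Cap, i + inputs Cap), (Cap, i)] @ v)"
    by (intro planar_isotopy exchange[OF order_refl]; unfold append_assoc;
        intro link_diagram_appendI[OF u])
       (use k v in \<open>auto simp: numeral_2_eq_2\<close>)
  moreover have "K ((u @ [(Cup, i)]) @ [(Cross Pos, (i + 1) + 1), (Cap, i + 1)] @ [(Cap, i)] @ v)
      = K ((u @ [(Cup, i)]) @ [(Cross (opposite Pos), i + 1), (Cap, (i + 1) + 1)] @ [(Cap, i)] @ v)"
    by (intro planar_isotopy slide_cap; unfold append_assoc; intro link_diagram_appendI[OF u])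
       (use k v in \<open>auto simp: numeral_2_eq_2\<close>)
  moreover have "K (u @ [(Cup, i), (Cross Pos, i + outputs Cup)] @ [(Cap, i + 1), (Cap, i)] @ v)
      = K (u @ [(Cross Pos, i + inputs Cup), (Cup, i)] @ [(Cap, i + 1), (Cap, i)] @ v)"
    by (intro planar_isotopy exchange[OF order_refl]; intro link_diagram_appendI[OF u])
       (use k v in \<open>auto simp: numeral_2_eq_2\<close>)
  moreover have "K ((u @ [(Cross Pos, i)]) @ [(Cup, i), (Cap, i + 1)] @ [(Cap, i)] @ v)
      = K ((u @ [(Cross Pos, i)]) @ [] @ [(Cap, i)] @ v)"
    by (intro planar_isotopy zigzag_right; unfold append_assoc; intro link_diagram_appendI[OF u])
       (use k v in \<open>auto simp: numeral_2_eq_2\<close>)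
  ultimately show ?thesis by simp
qed

text \<open>
  This is the closure of \<open>\<sigma>\<^sub>1\<^sup>n\<close> followed by the horizontal smoothing, after the minimum of the
  smoothing has been cancelled against the inner closing maximum.
\<close>

lemma curled_unknot:
  "K ([(Cup, 0), (Cup, 1)] @ replicate n (Cross Pos, 0) @ [(Cap, 0), (Cap, 0)]) = var_a ^ n"
proof (induction n)
  case 0
  have "K ([(Cup, 0)] @ [(Cup, 0 + 1), (Cap, 0)] @ [(Cap, 0)]) = K ([(Cup, 0)] @ [] @ [(Cap, 0)])"
    by (intro planar_isotopy zigzag_left) (auto simp: link_diagram_def)
  then show ?case using unknot by simp
next
  case (Suc n)
  define u :: "slice list" where "u = [(Cup, 0), (Cup, 1)] @ replicate n (Cross Pos, 0)"
  have "tangle 0 u 4"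
    unfolding u_def by (auto simp: tangle_append tangle_replicate_Cross)
  then have "K (u @ [(Cross Pos, 0), (Cap, 0)] @ [(Cap, 0)])
      = var_a * K (u @ [(Cap, 0)] @ [(Cap, 0)])"
    by (rule curl_below_Cap) auto
  with Suc.IH show ?case
    by (simp add: u_def replicate_app_Cons_same)
qed

lemma torus_0: "K (torus_link_2 0) = circle_value"
proof -
  have "K ([(Cup, 0)] @ [(Cup, 1), (Cap, 1)] @ [(Cap, 0)])
      = circle_value * K ([(Cup, 0)] @ [(Cap, 0)])"
    by (intro add_circle) (auto simp: link_diagram_def)
  then show ?thesis using unknot by (simp add: torus_link_2_def closure_2_braid_def)
qed

lemma torus_1: "K (torus_link_2 1) = var_a_inv"
proof -
  have "K ([(Cup, 0)] @ [(Cup, 0 + 1), (Cross Pos, 0), (Cap, 0 + 1)] @ [(Cap, 0)])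
      = var_a_inv * K ([(Cup, 0)] @ [(Cap, 0)])"
    by (intro positive_kink kink.kink_right) (auto simp: link_diagram_def)
  then show ?thesis using unknot by (simp add: torus_link_2_def closure_2_braid_def)
qed

lemma torus_recurrence:
  "K (torus_link_2 (q + 2))
    = var_z * K (torus_link_2 (q + 1)) - K (torus_link_2 q) + var_z * var_a ^ (q + 1)"
proof -
  let ?\<sigma> = "\<lambda>n. [(Cup, 0), (Cup, 1)] @ replicate n (Cross Pos, 0)"
  let ?caps = "[(Cap, 1), (Cap, 0)] :: slice list"
  have \<sigma>: "tangle 0 (?\<sigma> n) 4" for n
    by (auto simp: tangle_append tangle_replicate_Cross)
  have torus: "torus_link_2 n = ?\<sigma> n @ ?caps" for n
    by (simp add: torus_link_2_def closure_2_braid_def)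
  have skein_at_top:
    "K (?\<sigma> (q + 1) @ [(Cross Pos, 0)] @ ?caps) + K (?\<sigma> (q + 1) @ [(Cross Neg, 0)] @ ?caps)
      = var_z * (K (?\<sigma> (q + 1) @ ?caps) + K (?\<sigma> (q + 1) @ [(Cap, 0), (Cup, 0)] @ ?caps))"
    by (intro skein link_diagram_appendI[OF \<sigma>]) auto
  have pos: "?\<sigma> (q + 1) @ [(Cross Pos, 0)] @ ?caps = torus_link_2 (q + 2)"
    unfolding torus by (simp add: replicate_app_Cons_same)
  have neg: "K (?\<sigma> (q + 1) @ [(Cross Neg, 0)] @ ?caps) = K (torus_link_2 q)"
  proof -
    have "K (?\<sigma> q @ [(Cross Pos, 0), (Cross (opposite Pos), 0)] @ ?caps) = K (?\<sigma> q @ [] @ ?caps)"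
      by (intro reidemeister_2_3 R2 link_diagram_appendI[OF \<sigma>]) auto
    then show ?thesis unfolding torus by (simp add: replicate_app_Cons_same)
  qed
  have horizontal: "K (?\<sigma> (q + 1) @ [(Cap, 0), (Cup, 0)] @ ?caps) = var_a ^ (q + 1)"
  proof -
    have "K ((?\<sigma> (q + 1) @ [(Cap, 0)]) @ [(Cup, 0), (Cap, 0 + 1)] @ [(Cap, 0)])
        = K ((?\<sigma> (q + 1) @ [(Cap, 0)]) @ [] @ [(Cap, 0)])"
      by (intro planar_isotopy zigzag_right;
          simp only: append_assoc[of "?\<sigma> (q + 1)"]; intro link_diagram_appendI[OF \<sigma>]) auto
    then show ?thesis using curled_unknot[of "q + 1"] by simp
  qed
  from skein_at_top show ?thesis
    unfolding pos neg horizontal torus[symmetric] by (simp add: algebra_simps)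
qed

end

lemma P_recurrence: "P (n + 2) = var_z * P (n + 1) + var_z * var_a ^ (n + 1)"
proof -
  have "(\<Sum>i = 1..n. var_z * var_a ^ i * var_z ^ (n + 1 - i))
      = var_z * (\<Sum>i = 1..n. var_z * var_a ^ i * var_z ^ (n - i))"
    by (auto simp: sum_distrib_left Suc_diff_le algebra_simps intro!: sum.cong)
  then show ?thesis
    by (simp add: P_def activity_sum_def algebra_simps)
qed

lemma of_z_poly_pCons: "of_z_poly (pCons c p) = of_int c + var_z * of_z_poly p"
  by (simp add: of_z_poly_def map_poly_pCons)

lemma of_z_poly_diff: "of_z_poly (p - q) = of_z_poly p - of_z_poly q"
proof -
  have "map_poly of_int (p - q) = (map_poly of_int p - map_poly of_int q :: laurent poly)"
    by (intro poly_eqI) (simp add: coeff_map_poly)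
  then show ?thesis by (simp add: of_z_poly_def)
qed

lemma of_z_poly_g:
  "of_z_poly (g 0) = 1"
  "of_z_poly (g (Suc 0)) = var_z"
  "of_z_poly (g (Suc (Suc n))) = var_z * of_z_poly (g (Suc n)) - of_z_poly (g n)"
  by (simp_all add: of_z_poly_diff of_z_poly_pCons one_pCons of_z_poly_def[of 0])

text \<open>
  Let \<open>T\<close> be the operator taking a sequence \<open>y\<close> to \<open>y\<^bsub>n+2\<^esub> - z y\<^bsub>n+1\<^esub> + y\<^sub>n\<close>. Then \<open>T x = c\<close>, whereas
  \<open>T p = c + p\<close>. Since \<open>h\<close> solves the homogeneous recurrence with \<open>h 0 = 1\<close> and \<open>h 1 = z\<close> (as if
  \<open>h (- 1) = 0\<close>), \<open>T\<close> maps the convolution of \<open>p\<close> and \<open>h\<close>, shifted by two, to \<open>p\<close>. So subtracting it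
  from \<open>p\<close> gives a solution of the recurrence of \<open>x\<close>. The range \<open>{..<n - 1}\<close> makes the convolution
  empty for \<open>n = 0\<close> and \<open>n = 1\<close>, as the initial values require.
\<close>

lemma second_order_recurrence_solution:
  fixes x p h c :: "nat \<Rightarrow> 'a :: comm_ring_1" and z :: 'a
  assumes x: "x 0 = p 0" "x 1 = p 1" "\<And>n. x (n + 2) = z * x (n + 1) - x n + c n"
    and p: "\<And>n. p (n + 2) = z * p (n + 1) + c n"
    and h: "h 0 = 1" "h 1 = z" "\<And>n. h (n + 2) = z * h (n + 1) - h n"
  shows "x n = p n - (\<Sum>i<n - 1. p i * h (n - 2 - i))"
proof (induction n rule: less_induct)
  case (less n)
  \<comment> \<open>For \<open>n = 2\<close> the convolution is a single term, too short to split off two terms as below.\<close>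
  consider "n = 0" | "n = 1" | "n = 2" | m where "n = m + 3"
    by atomize_elim presburger
  then show ?case
  proof cases
    case 3
    then show ?thesis
      using x(1,2) x(3)[of 0] p[of 0] h(1) by (simp add: numeral_2_eq_2)
  next
    case (4 m)
    \<comment> \<open>The recurrence of \<open>h\<close> rewrites only \<open>h 2, h 3, \<dots>\<close>, so the terms \<open>i = m\<close> and \<open>i = m + 1\<close> of the
      convolution, with factors \<open>h 1\<close> and \<open>h 0\<close>, are kept apart.\<close>
    have "(\<Sum>i<m. p i * h (m + 1 - i)) = (\<Sum>i<m. p i * (z * h (m - i) - h (m - 1 - i)))"
    proof (intro sum.cong refl)
      fix i assume "i \<in> {..<m}"
      then show "p i * h (m + 1 - i) = p i * (z * h (m - i) - h (m - 1 - i))"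
        using h(3)[of "m - 1 - i"] by (simp add: Suc_diff_Suc Suc_diff_le)
    qed
    then have convolution: "(\<Sum>i<m. p i * h (m + 1 - i))
        = z * (\<Sum>i<m. p i * h (m - i)) - (\<Sum>i<m. p i * h (m - 1 - i))"
      by (simp add: sum_distrib_left sum_subtractf algebra_simps)
    have x3: "x (m + 3) = z * x (m + 2) - x (m + 1) + c (m + 1)"
      using x(3)[of "m + 1"] by (simp add: numeral_eq_Suc)
    have p3: "p (m + 3) = z * p (m + 2) + c (m + 1)"
      using p[of "m + 1"] by (simp add: numeral_eq_Suc)
    have x2: "x (m + 2) = p (m + 2) - (\<Sum>i<m + 1. p i * h (m - i))"
      using less.IH[of "m + 2"] 4 by simp
    have x1: "x (m + 1) = p (m + 1) - (\<Sum>i<m. p i * h (m - 1 - i))"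
      using less.IH[of "m + 1"] 4 by simp
    have "x (m + 3)
        = p (m + 3) - ((\<Sum>i<m. p i * h (m + 1 - i)) + p m * h 1 + p (m + 1) * h 0)"
      unfolding convolution x3 p3 x2 x1 h(1,2) by (simp add: algebra_simps h(1))
    then show ?thesis
      using 4 by (simp add: numeral_eq_Suc)
  qed (use x in simp_all)
qed

theorem theorem8p5:
  fixes K :: "slice list \<Rightarrow> laurent" and q :: nat
  assumes "kauffman_K K"
    and "q \<ge> 2"
  shows "K (torus_link_2 q) = P q - (\<Sum>i = 0..q - 2. P i * of_z_poly (g (q - 2 - i)))"
proof -
  interpret kauffman_K K by (fact assms(1))
  have "K (torus_link_2 q) = P q - (\<Sum>i<q - 1. P i * of_z_poly (g (q - 2 - i)))"
  proof (rule second_order_recurrence_solution)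
    show "K (torus_link_2 0) = P 0" "K (torus_link_2 1) = P 1"
      using torus_0 torus_1 by (simp_all add: P_def)
    show "of_z_poly (g (n + 2)) = var_z * of_z_poly (g (n + 1)) - of_z_poly (g n)" for n
      using of_z_poly_g(3) by (simp del: g.simps)
  qed (use of_z_poly_g(1,2) in \<open>simp_all only: torus_recurrence P_recurrence One_nat_def\<close>)
  moreover have "{..<q - 1} = {0..q - 2}"
    using assms(2) by auto
  ultimately show ?thesis by simp
qed

end
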